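(* Let $\Omega$ be a locally compact Hausdorff space and let $A\subseteq C_0(\Omega)_+$. Then $A$ is order bounded in $C_0(\Omega)$ if and only if $A$ is uniformly bounded (i.e., there is a real $M$ with $f(t)\leqslant M$ for all $f\in A$ and $t\in\Omega$) and for every $\varepsilon>0$ there exists a compact set $K\subseteq\Omega$ such that $f(t)<\varepsilon$ whenever $f\in A$ and $t\notin K$.
   Context: $C_0(\Omega)$ is the vector lattice (pointwise operations and order) of all continuous functions $f\colon\Omega\to\mathbb R$ such that for every $\varepsilon>0$ there exists a compact set $K$ with $|f(t)|<\varepsilon$ whenever $t\notin K$; $C_0(\Omega)_+$ is the set of its non-negative elements. A subset of a vector lattice is order bounded if it is contained in an order interval; for $A\subseteq C_0(\Omega)_+$ this means there is $g\in C_0(\Omega)$ with $f\leqslant g$ for all $f\in A$. *)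

theory Defs
  imports "HOL-Analysis.Analysis"
begin

text \<open>
  The space is an abstract topology \<open>X\<close> with underlying set \<open>topspace X\<close>. A function on it is
  a HOL function in \<open>extensional (topspace X)\<close>, so that two elements of \<open>C0 X\<close> are equal
  iff they agree on \<open>topspace X\<close>; order statements are relativised to \<open>topspace X\<close>.
\<close>

definition C0 :: "'a topology \<Rightarrow> ('a \<Rightarrow> real) set" where
  "C0 X = {f \<in> extensional (topspace X). continuous_map X euclideanreal f \<and>
     (\<forall>\<epsilon>>0. \<exists>K. compactin X K \<and> (\<forall>t \<in> topspace X - K. \<bar>f t\<bar> < \<epsilon>))}"

definition C0_le :: "'a topology \<Rightarrow> ('a \<Rightarrow> real) \<Rightarrow> ('a \<Rightarrow> real) \<Rightarrow> bool" where
  "C0_le X f g \<longleftrightarrow> (\<forall>t \<in> topspace X. f t \<le> g t)"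

definition C0_nonneg :: "'a topology \<Rightarrow> ('a \<Rightarrow> real) set" where
  "C0_nonneg X = {f \<in> C0 X. C0_le X (\<lambda>t \<in> topspace X. 0) f}"

definition C0_interval :: "'a topology \<Rightarrow> ('a \<Rightarrow> real) \<Rightarrow> ('a \<Rightarrow> real) \<Rightarrow> ('a \<Rightarrow> real) set" where
  "C0_interval X l u = {f \<in> C0 X. C0_le X l f \<and> C0_le X f u}"

definition C0_order_bounded :: "'a topology \<Rightarrow> ('a \<Rightarrow> real) set \<Rightarrow> bool" where
  "C0_order_bounded X A \<longleftrightarrow> (\<exists>l \<in> C0 X. \<exists>u \<in> C0 X. A \<subseteq> C0_interval X l u)"

end

theory Submission
  imports Defs
begin

text \<open>
  If \<open>A\<close> lies below some \<open>u\<close> in \<open>C0 X\<close>, then \<open>u\<close> passes its boundedness and its decay at infinity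
  on to every element of \<open>A\<close>, with constants and compact sets that depend only on \<open>u\<close>.

  The converse needs a continuous majorant; the pointwise supremum of \<open>A\<close> satisfies both
  estimates but need not be continuous. Instead, a majorant is assembled from bump functions.
  Let \<open>c 0\<close> be a non-negative upper bound for the values of all functions in \<open>A\<close>, let
  \<open>c (Suc n) = (1/2) ^ n\<close>, and choose compact sets \<open>K n\<close> such that every \<open>f\<close> in \<open>A\<close> is
  below \<open>c (Suc n)\<close> off \<open>K n\<close>. Let \<open>h n\<close> be an element of \<open>C0 X\<close> with values in
  \<open>{0..c n}\<close> that equals \<open>c n\<close> on \<open>K n\<close> (\<open>C0_bump\<close>), and let \<open>g\<close> be the sum of the \<open>h n\<close>. The
  weights are summable, so \<open>g\<close> is a uniform limit of elements of \<open>C0 X\<close> and hence belongs to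
  \<open>C0 X\<close> (\<open>C0_suminf\<close>). Given a point \<open>t\<close> with \<open>f t > 0\<close>, some \<open>K n\<close> contains \<open>t\<close>, because the
  thresholds \<open>c (Suc n)\<close> tend to \<open>0\<close>. For the first such \<open>n\<close>, minimality (or the global bound, if
  \<open>n = 0\<close>) gives \<open>f t \<le> c n\<close>, and \<open>c n = h n t \<le> g t\<close>.
\<close>

section \<open>Closure properties of the functions vanishing at infinity\<close>

lemma C0_zero: "(\<lambda>t\<in>topspace X. 0) \<in> C0 X"
proof -
  have "continuous_map X euclideanreal (\<lambda>t\<in>topspace X. 0)"
    by (rule continuous_map_eq[of X _ "\<lambda>_. 0"]) auto
  then show ?thesis
    unfolding C0_def by (auto intro: compactin_empty)
qed

lemma C0_add:
  assumes "f \<in> C0 X" "g \<in> C0 X"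
  shows "(\<lambda>t\<in>topspace X. f t + g t) \<in> C0 X"
proof -
  have "continuous_map X euclideanreal (\<lambda>t. f t + g t)"
    using assms by (intro continuous_map_add) (auto simp: C0_def)
  then have "continuous_map X euclideanreal (\<lambda>t\<in>topspace X. f t + g t)"
    by (rule continuous_map_eq) auto
  moreover have "\<exists>K. compactin X K \<and> (\<forall>t\<in>topspace X - K. \<bar>f t + g t\<bar> < \<epsilon>)" if "\<epsilon> > 0" for \<epsilon>
  proof -
    have "\<epsilon>/2 > 0" using that by simp
    then obtain K L where "compactin X K" "\<forall>t\<in>topspace X - K. \<bar>f t\<bar> < \<epsilon>/2"
      and "compactin X L" "\<forall>t\<in>topspace X - L. \<bar>g t\<bar> < \<epsilon>/2"
      using assms unfolding C0_def by blast
    moreover have "\<bar>x + y\<bar> < \<epsilon>" if "\<bar>x\<bar> < \<epsilon>/2" "\<bar>y\<bar> < \<epsilon>/2" for x y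
      using that by linarith
    ultimately have "compactin X (K \<union> L) \<and> (\<forall>t\<in>topspace X - (K \<union> L). \<bar>f t + g t\<bar> < \<epsilon>)"
      by (simp add: compactin_Un)
    then show ?thesis ..
  qed
  ultimately show ?thesis
    by (simp add: C0_def)
qed

lemma C0_sum:
  fixes n :: nat
  assumes "\<And>i. f i \<in> C0 X"
  shows "(\<lambda>t\<in>topspace X. \<Sum>i<n. f i t) \<in> C0 X"
proof (induction n)
  case 0
  then show ?case by (simp only: lessThan_0 sum.empty C0_zero)
next
  case (Suc n)
  have "(\<lambda>t\<in>topspace X. \<Sum>i<Suc n. f i t) =
      (\<lambda>t\<in>topspace X. (\<lambda>t\<in>topspace X. \<Sum>i<n. f i t) t + f n t)"
    by (rule restrict_ext) simp
  then show ?case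
    using C0_add[OF Suc assms[of n]] by (simp only:)
qed

text \<open>
  Decay at infinity survives because one \<open>f n\<close> within \<open>\<epsilon>/2\<close> of \<open>g\<close> already supplies the
  compact set: where \<open>\<bar>f n t\<bar> < \<epsilon>/2\<close>, also \<open>\<bar>g t\<bar> < \<epsilon>\<close>.
\<close>

lemma C0_uniform_limit:
  fixes f :: "nat \<Rightarrow> 'a \<Rightarrow> real"
  assumes f: "\<And>n. f n \<in> C0 X" and lim: "uniform_limit (topspace X) f g sequentially"
  shows "(\<lambda>t\<in>topspace X. g t) \<in> C0 X"
proof -
  have "continuous_map X Met_TC.mtopology g"
  proof (rule Met_TC.continuous_map_uniform_limit[where f = f and F = sequentially])
    show "\<forall>\<^sub>F n in sequentially. continuous_map X Met_TC.mtopology (f n)"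
      using f by (simp add: C0_def)
    show "\<forall>\<^sub>F n in sequentially. \<forall>t\<in>topspace X. g t \<in> UNIV \<and> dist (f n t) (g t) < \<epsilon>"
      if "0 < \<epsilon>" for \<epsilon>
      using uniform_limitD[OF lim that] by simp
  qed simp
  then have "continuous_map X euclideanreal (\<lambda>t\<in>topspace X. g t)"
    unfolding mtopology_is_euclidean by (rule continuous_map_eq) auto
  moreover have "\<exists>K. compactin X K \<and> (\<forall>t\<in>topspace X - K. \<bar>g t\<bar> < \<epsilon>)" if "\<epsilon> > 0" for \<epsilon>
  proof -
    have half: "\<epsilon>/2 > 0" using that by simp
    obtain n where n: "\<forall>t\<in>topspace X. dist (f n t) (g t) < \<epsilon>/2"
      using eventually_happens'[OF sequentially_bot uniform_limitD[OF lim half]] by blast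
    obtain K where "compactin X K" "\<forall>t\<in>topspace X - K. \<bar>f n t\<bar> < \<epsilon>/2"
      using f[of n] half unfolding C0_def by blast
    moreover have "\<bar>y\<bar> < \<epsilon>" if "dist x y < \<epsilon>/2" "\<bar>x\<bar> < \<epsilon>/2" for x y
      using that unfolding dist_real_def by linarith
    ultimately have "compactin X K \<and> (\<forall>t\<in>topspace X - K. \<bar>g t\<bar> < \<epsilon>)"
      using n by blast
    then show ?thesis ..
  qed
  ultimately show ?thesis
    by (simp add: C0_def)
qed

lemma C0_suminf:
  assumes f: "\<And>n. f n \<in> C0 X" and bound: "\<And>n t. t \<in> topspace X \<Longrightarrow> \<bar>f n t\<bar> \<le> c n"
    and "summable c"
  shows "(\<lambda>t\<in>topspace X. \<Sum>n. f n t) \<in> C0 X"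
proof (rule C0_uniform_limit)
  show "(\<lambda>t\<in>topspace X. \<Sum>i<n. f i t) \<in> C0 X" for n
    by (rule C0_sum[OF f])
  have "uniform_limit (topspace X) (\<lambda>n t. \<Sum>i<n. f i t) (\<lambda>t. \<Sum>n. f n t) sequentially"
    using assms by (intro Weierstrass_m_test) auto
  then show "uniform_limit (topspace X) (\<lambda>n. \<lambda>t\<in>topspace X. \<Sum>i<n. f i t)
      (\<lambda>t. \<Sum>n. f n t) sequentially"
    by (rule uniform_limit_cong'[THEN iffD1, rotated -1]) auto
qed

lemma C0_bounded_above:
  assumes "u \<in> C0 X"
  obtains M where "\<And>t. t \<in> topspace X \<Longrightarrow> u t \<le> M"
proof -
  obtain K where K: "compactin X K" "\<forall>t\<in>topspace X - K. \<bar>u t\<bar> < 1"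
    using assms unfolding C0_def by (auto dest!: spec[of _ "1::real"])
  have "compact (u ` K)"
    using image_compactin[OF K(1), of euclideanreal u] assms by (simp add: C0_def)
  then obtain B where "\<forall>y\<in>u ` K. norm y \<le> B"
    using compact_imp_bounded bounded_iff by metis
  with K(2) have "u t \<le> max 1 B" if "t \<in> topspace X" for t
    using that by (cases "t \<in> K") force+
  then show thesis by (rule that)
qed

section \<open>Continuous bumps\<close>

text \<open>
  Local compactness puts \<open>K\<close> inside an open set \<open>U\<close> that is contained in a compact set \<open>L\<close>.
  Urysohn separation of \<open>K\<close> from the complement of \<open>U\<close> then makes the function vanish off \<open>L\<close>.
\<close>

lemma C0_bump:
  assumes "locally_compact_space X" "Hausdorff_space X" "compactin X K" "0 \<le> c"
  obtains h where "h \<in> C0 X" "\<And>t. t \<in> topspace X \<Longrightarrow> 0 \<le> h t \<and> h t \<le> c"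
    "\<And>t. t \<in> K \<Longrightarrow> h t = c"
proof -
  obtain U L where UL: "openin X U" "compactin X L" "K \<subseteq> U" "U \<subseteq> L"
    using assms locally_compact_space_compact_closed_compact by metis
  have "completely_regular_space X"
    using assms locally_compact_regular_imp_completely_regular_space by blast
  moreover have "closedin X (topspace X - U)" "disjnt K (topspace X - U)"
    using UL by (auto simp: disjnt_def)
  ultimately obtain h where cont: "continuous_map X (top_of_set {0..c}) h"
    and off: "h ` (topspace X - U) \<subseteq> {0}" and on: "h ` K \<subseteq> {c}"
    using Urysohn_completely_regular_compact_closed assms by metis
  have "continuous_map X euclideanreal (restrict h (topspace X))"
    using continuous_map_into_fulltopology[OF cont] by (rule continuous_map_eq) auto
  moreover have "\<forall>t\<in>topspace X - L. \<bar>h t\<bar> < \<epsilon>" if "\<epsilon> > 0" for \<epsilon>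
    using off UL(4) that by force
  ultimately have "restrict h (topspace X) \<in> C0 X"
    using UL(2) unfolding C0_def by auto
  moreover have "0 \<le> h t \<and> h t \<le> c" if "t \<in> topspace X" for t
    using cont that by (auto simp: continuous_map_in_subtopology)
  moreover have "h t = c" "t \<in> topspace X" if "t \<in> K" for t
    using on that compactin_subset_topspace[OF assms(3)] by auto
  ultimately show thesis
    by (intro that[of "restrict h (topspace X)"]) auto
qed

section \<open>A majorant from uniform estimates\<close>

lemma C0_common_majorant:
  fixes X :: "'a topology" and A :: "('a \<Rightarrow> real) set"
  assumes X: "locally_compact_space X" "Hausdorff_space X"
    and bound: "\<And>f t. f \<in> A \<Longrightarrow> t \<in> topspace X \<Longrightarrow> f t \<le> M"
    and vanish: "\<And>\<epsilon>. \<epsilon> > 0 \<Longrightarrow> \<exists>K. compactin X K \<and> (\<forall>f\<in>A. \<forall>t\<in>topspace X - K. f t < \<epsilon>)"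
  obtains g where "g \<in> C0 X" "\<And>f. f \<in> A \<Longrightarrow> C0_le X f g"
proof -
  \<comment> \<open>The shift of index makes \<open>c n\<close> both the height of the bump on \<open>K n\<close> and a bound for \<open>A\<close>
    at every point outside the preceding compact set; \<open>max\<close> covers a negative \<open>M\<close>.\<close>
  define c :: "nat \<Rightarrow> real" where "c = case_nat (max M 0) (\<lambda>n. (1/2)^n)"
  have c0: "c 0 = max M 0" and cSuc: "c (Suc n) = (1/2)^n" for n
    by (simp_all add: c_def)
  have c_nonneg: "0 \<le> c n" for n
    by (cases n) (simp_all add: c0 cSuc)
  have "summable (\<lambda>n. c (Suc n))"
    by (simp add: cSuc)
  then have "summable c"
    by (simp only: summable_Suc_iff)
  have "\<forall>n. \<exists>K. compactin X K \<and> (\<forall>f\<in>A. \<forall>t\<in>topspace X - K. f t < c (Suc n))"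
    by (intro allI vanish) (simp add: cSuc)
  then obtain K where comp: "\<And>n. compactin X (K n)"
    and K: "\<And>n f t. f \<in> A \<Longrightarrow> t \<in> topspace X \<Longrightarrow> t \<notin> K n \<Longrightarrow> f t < c (Suc n)"
    by (metis DiffI)
  have "\<forall>n. \<exists>h. h \<in> C0 X \<and> (\<forall>t\<in>topspace X. 0 \<le> h t \<and> h t \<le> c n) \<and> (\<forall>t\<in>K n. h t = c n)"
    using C0_bump[OF X comp c_nonneg] by metis
  then obtain h where h: "\<And>n. h n \<in> C0 X"
    and h_range: "\<And>n t. t \<in> topspace X \<Longrightarrow> 0 \<le> h n t \<and> h n t \<le> c n"
    and h_eq: "\<And>n t. t \<in> K n \<Longrightarrow> h n t = c n"
    by metis
  define g where "g = (\<lambda>t\<in>topspace X. \<Sum>n. h n t)"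
  have "g \<in> C0 X"
    unfolding g_def using h h_range \<open>summable c\<close> by (intro C0_suminf[where c = c]) auto
  moreover have "f t \<le> g t" if f: "f \<in> A" and t: "t \<in> topspace X" for f t
  proof -
    have summ: "summable (\<lambda>n. h n t)"
      using h_range[OF t] by (intro summable_comparison_test'[OF \<open>summable c\<close>, of 0]) auto
    have g_ge: "h n t \<le> g t" for n
      using sum_le_suminf[OF summ, of "{n}"] h_range[OF t] t by (simp add: g_def)
    show ?thesis
    proof (cases "f t > 0")
      case True
      then obtain m where "c (Suc m) < f t"
        using real_arch_pow_inv[of "f t" "1/2"] by (auto simp: cSuc)
      then have "t \<in> K m"
        using K[OF f t, of m] by (meson less_asym)
      define n where "n = (LEAST n. t \<in> K n)"
      have n: "t \<in> K n"
        unfolding n_def using \<open>t \<in> K m\<close> by (rule LeastI)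
      have "f t \<le> c n"
      proof (cases n)
        case 0
        then show ?thesis using bound[OF f t] by (simp add: c0)
      next
        case (Suc k)
        then have "t \<notin> K k"
          unfolding n_def by (metis lessI not_less_Least)
        then show ?thesis using K[OF f t] Suc by (simp add: less_imp_le)
      qed
      then show ?thesis using h_eq[OF n] g_ge[of n] by simp
    next
      case False
      then show ?thesis using g_ge[of 0] h_range[OF t, of 0] by linarith
    qed
  qed
  ultimately show thesis
    using that by (auto simp: C0_le_def)
qed

section \<open>Order boundedness\<close>

theorem proposition3p5:
  fixes X :: "'a topology" and A :: "('a \<Rightarrow> real) set"
  assumes "locally_compact_space X" and "Hausdorff_space X"
    and "A \<subseteq> C0_nonneg X"
  shows "C0_order_bounded X A \<longleftrightarrow>
    (\<exists>M::real. \<forall>f \<in> A. \<forall>t \<in> topspace X. f t \<le> M) \<and>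
    (\<forall>\<epsilon>>0. \<exists>K. compactin X K \<and> (\<forall>f \<in> A. \<forall>t \<in> topspace X - K. f t < \<epsilon>))"
    (is "?L \<longleftrightarrow> ?bounded \<and> ?vanishing")
proof
  assume ?L
  then obtain u where u: "u \<in> C0 X" and le: "\<And>f t. f \<in> A \<Longrightarrow> t \<in> topspace X \<Longrightarrow> f t \<le> u t"
    unfolding C0_order_bounded_def C0_interval_def C0_le_def by blast
  obtain M where "\<And>t. t \<in> topspace X \<Longrightarrow> u t \<le> M"
    using C0_bounded_above[OF u] by blast
  then have ?bounded
    using le by (meson order_trans)
  moreover have ?vanishing
  proof (intro allI impI)
    fix \<epsilon> :: real
    assume "\<epsilon> > 0"
    then obtain K where "compactin X K" "\<forall>t\<in>topspace X - K. \<bar>u t\<bar> < \<epsilon>"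
      using u unfolding C0_def by blast
    then show "\<exists>K. compactin X K \<and> (\<forall>f\<in>A. \<forall>t\<in>topspace X - K. f t < \<epsilon>)"
      using le by (metis DiffD1 abs_ge_self le_less_trans)
  qed
  ultimately show "?bounded \<and> ?vanishing" ..
next
  assume R: "?bounded \<and> ?vanishing"
  then obtain M where "\<And>f t. f \<in> A \<Longrightarrow> t \<in> topspace X \<Longrightarrow> f t \<le> M"
    by blast
  then obtain g where "g \<in> C0 X" "\<And>f. f \<in> A \<Longrightarrow> C0_le X f g"
    using C0_common_majorant[OF assms(1,2), of A M] R by blast
  moreover have "A \<subseteq> C0 X" "\<And>f. f \<in> A \<Longrightarrow> C0_le X (\<lambda>t\<in>topspace X. 0) f"
    using assms(3) by (auto simp: C0_nonneg_def)
  ultimately show ?L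
    unfolding C0_order_bounded_def C0_interval_def using C0_zero by blast
qed

end
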